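(* For every positive integer $n$, the number of isometry classes of $n$-point metric spaces in $\mathcal{A}^3_{\infty,0,7,8}$ is $$\frac{\lfloor n/2\rfloor^2}{2}+\frac{3\lfloor n/2\rfloor}{2}+1.$$
   Context: $\mathcal{A}^3_{\infty,0,7,8}$ is the class of finite metric spaces, all of whose distances between distinct points lie in $\{1,2,3\}$, in which for every three distinct points the multiset of their pairwise distances is one of $\{1,1,2\}$, $\{1,2,3\}$, $\{2,2,2\}$. *)

theory Defs
  imports "HOL-Analysis.Analysis" "HOL-Library.Multiset"
begin

definition isometric_spaces :: "'a metric \<Rightarrow> 'b metric \<Rightarrow> bool" where
  "isometric_spaces X Y \<longleftrightarrow>
     (\<exists>f. bij_betw f (mspace X) (mspace Y) \<and>
          (\<forall>x\<in>mspace X. \<forall>y\<in>mspace X. mdist Y (f x) (f y) = mdist X x y))"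

text \<open>The class with diameter 3 and parameters infinity, 0, 7, 8, restricted to the metric
  spaces whose points lie in the type \<open>'a\<close>.\<close>

definition class_A3_inf_0_7_8 :: "'a metric set" where
  "class_A3_inf_0_7_8 =
     {X. finite (mspace X) \<and>
         (\<forall>x\<in>mspace X. \<forall>y\<in>mspace X. x \<noteq> y \<longrightarrow> mdist X x y \<in> {1, 2, 3}) \<and>
         (\<forall>x\<in>mspace X. \<forall>y\<in>mspace X. \<forall>z\<in>mspace X. x \<noteq> y \<and> y \<noteq> z \<and> x \<noteq> z \<longrightarrow>
            {#mdist X x y, mdist X y z, mdist X x z#}
              \<in> {{#1, 1, 2#}, {#1, 2, 3#}, {#2, 2, 2#}})}"

definition isometry_classes :: "'a metric set \<Rightarrow> 'a metric set set" where
  "isometry_classes S = S // {(X, Y). X \<in> S \<and> Y \<in> S \<and> isometric_spaces X Y}"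

lemma isometric_spaces_refl: "isometric_spaces X X"
  unfolding isometric_spaces_def by (rule exI[of _ id]) auto

lemma isometric_spaces_sym:
  assumes "isometric_spaces X Y"
  shows "isometric_spaces Y X"
proof -
  obtain f where f: "bij_betw f (mspace X) (mspace Y)"
    and d: "\<And>x y. x \<in> mspace X \<Longrightarrow> y \<in> mspace X \<Longrightarrow> mdist Y (f x) (f y) = mdist X x y"
    using assms unfolding isometric_spaces_def by blast
  let ?g = "inv_into (mspace X) f"
  have g: "bij_betw ?g (mspace Y) (mspace X)"
    by (rule bij_betw_inv_into[OF f])
  have "mdist X (?g x) (?g y) = mdist Y x y" if "x \<in> mspace Y" "y \<in> mspace Y" for x y
    using d[of "?g x" "?g y"] that bij_betw_apply[OF g] bij_betw_inv_into_right[OF f] by simp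
  with g show ?thesis
    unfolding isometric_spaces_def by blast
qed

lemma isometric_spaces_trans:
  assumes "isometric_spaces X Y" "isometric_spaces Y Z"
  shows "isometric_spaces X Z"
proof -
  obtain f where f: "bij_betw f (mspace X) (mspace Y)"
    and d: "\<And>x y. x \<in> mspace X \<Longrightarrow> y \<in> mspace X \<Longrightarrow> mdist Y (f x) (f y) = mdist X x y"
    using assms(1) unfolding isometric_spaces_def by blast
  obtain g where g: "bij_betw g (mspace Y) (mspace Z)"
    and e: "\<And>x y. x \<in> mspace Y \<Longrightarrow> y \<in> mspace Y \<Longrightarrow> mdist Z (g x) (g y) = mdist Y x y"
    using assms(2) unfolding isometric_spaces_def by blast
  have "mdist Z ((g \<circ> f) x) ((g \<circ> f) y) = mdist X x y" if "x \<in> mspace X" "y \<in> mspace X" for x y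
    using d[OF that] e[of "f x" "f y"] that bij_betw_apply[OF f] by simp
  with bij_betw_trans[OF f g] show ?thesis
    unfolding isometric_spaces_def by blast
qed

lemma equiv_isometric_spaces:
  "equiv S {(X, Y). X \<in> S \<and> Y \<in> S \<and> isometric_spaces X Y}"
  by (rule equivI)
    (auto simp: refl_on_def sym_def trans_def
      intro: isometric_spaces_refl isometric_spaces_sym isometric_spaces_trans)

text \<open>A finite metric space over any type has an isometric copy over any given infinite type,
  so counting isometry classes over one infinite type counts them all.\<close>

lemma isometric_copy_exists:
  fixes X :: "'b metric"
  assumes fin: "finite (mspace X)" and inf: "infinite (UNIV :: 'a set)"
  shows "\<exists>Y :: 'a metric. isometric_spaces X Y"
proof -
  obtain N :: "'a set" where N: "finite N" "card N = card (mspace X)"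
    using infinite_arbitrarily_large[OF inf] by blast
  then obtain g where g: "bij_betw g N (mspace X)"
    using finite_same_card_bij[OF N(1) fin] by blast
  define d where "d x y = mdist X (g x) (g y)" for x y
  have mem: "g x \<in> mspace X" if "x \<in> N" for x
    using bij_betw_apply[OF g that] .
  have inj: "g x = g y \<longleftrightarrow> x = y" if "x \<in> N" "y \<in> N" for x y
    using bij_betw_imp_inj_on[OF g] that by (auto dest: inj_onD)
  have "Metric_space N d"
    by unfold_locales (auto simp: d_def mem inj mdist_commute mdist_triangle)
  then have Y: "mspace (metric (N, d)) = N" "mdist (metric (N, d)) = d"
    by (simp_all add: Metric_space.mspace_metric Metric_space.mdist_metric)
  have "isometric_spaces (metric (N, d)) X"
    unfolding isometric_spaces_def using g by (intro exI[of _ g]) (simp add: Y d_def)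
  then show ?thesis
    using isometric_spaces_sym by blast
qed

end

theory Submission
  imports Defs
begin

text \<open>Every admissible triangle has an even number of odd sides, so the points split into two parts
  such that a distance is 2 exactly within a part. No triangle has two sides of length 3, so the
  pairs at distance 3 form a matching between the parts. Up to isometry the space is thus determined
  by the size \<open>k \<le> n / 2\<close> of the smaller part and the size \<open>m \<le> k\<close> of the matching.\<close>

section \<open>Parity and matching form of the triangle condition\<close>

text \<open>The nested equivalence is true exactly when one or three of the sides equal 2, which
  leaves 112, 123, 233 and 222; forbidding two sides of length 3 removes 233.\<close>

lemma admissible_triangle_iff:
  fixes a b c :: real
  assumes "a \<in> {1, 2, 3}" "b \<in> {1, 2, 3}" "c \<in> {1, 2, 3}"
  shows "{#a, b, c#} \<in> {{#1, 1, 2#}, {#1, 2, 3#}, {#2, 2, 2#}} \<longleftrightarrow>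
    (a = 2 \<longleftrightarrow> (b = 2 \<longleftrightarrow> c = 2)) \<and>
    \<not> (a = 3 \<and> b = 3) \<and> \<not> (b = 3 \<and> c = 3) \<and> \<not> (a = 3 \<and> c = 3)"
proof -
  \<comment> \<open>Both multisets live on {1, 2, 3}, so three counts decide equality and the claim
    becomes a check of the 27 choices of sides.\<close>
  have "{#a, b, c#} = N \<longleftrightarrow> (\<forall>x\<in>{1, 2, 3}. count {#a, b, c#} x = count N x)"
    if "set_mset N \<subseteq> {1, 2, 3}" for N
  proof -
    have "count {#a, b, c#} x = count N x" if "x \<notin> {1, 2, 3}" for x
    proof -
      have "count N x = 0"
        using \<open>set_mset N \<subseteq> {1, 2, 3}\<close> that by (meson count_inI subsetD)
      moreover have "a \<noteq> x" "b \<noteq> x" "c \<noteq> x"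
        using assms that by auto
      ultimately show ?thesis by simp
    qed
    then show ?thesis
      unfolding multiset_eq_iff by blast
  qed
  then have "{#a, b, c#} \<in> {{#1, 1, 2#}, {#1, 2, 3#}, {#2, 2, 2#}} \<longleftrightarrow>
    (\<exists>N\<in>{{#1, 1, 2#}, {#1, 2, 3#}, {#2, 2, 2#}}.
      \<forall>x\<in>{1, 2, 3}. count {#a, b, c#} x = count N x)"
    by simp
  also have "\<dots> \<longleftrightarrow> (a = 2 \<longleftrightarrow> (b = 2 \<longleftrightarrow> c = 2)) \<and>
    \<not> (a = 3 \<and> b = 3) \<and> \<not> (b = 3 \<and> c = 3) \<and> \<not> (a = 3 \<and> c = 3)"
    using assms unfolding insert_iff empty_iff by (elim disjE; simp)
  finally show ?thesis .
qed

lemma class_A3_inf_0_7_8_iff: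
  "X \<in> class_A3_inf_0_7_8 \<longleftrightarrow>
     finite (mspace X) \<and>
     (\<forall>x\<in>mspace X. \<forall>y\<in>mspace X. x \<noteq> y \<longrightarrow> mdist X x y \<in> {1, 2, 3}) \<and>
     (\<forall>x\<in>mspace X. \<forall>y\<in>mspace X. \<forall>z\<in>mspace X. x \<noteq> y \<and> y \<noteq> z \<and> x \<noteq> z \<longrightarrow>
        (mdist X x y = 2 \<longleftrightarrow> (mdist X y z = 2 \<longleftrightarrow> mdist X x z = 2)) \<and>
        \<not> (mdist X x y = 3 \<and> mdist X y z = 3))"
    (is "_ \<longleftrightarrow> ?fin \<and> ?dist \<and> ?tri")
proof -
  have "X \<in> class_A3_inf_0_7_8 \<longleftrightarrow> ?fin \<and> ?dist \<and>
     (\<forall>x\<in>mspace X. \<forall>y\<in>mspace X. \<forall>z\<in>mspace X. x \<noteq> y \<and> y \<noteq> z \<and> x \<noteq> z \<longrightarrow>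
        (mdist X x y = 2 \<longleftrightarrow> (mdist X y z = 2 \<longleftrightarrow> mdist X x z = 2)) \<and>
        \<not> (mdist X x y = 3 \<and> mdist X y z = 3) \<and>
        \<not> (mdist X y z = 3 \<and> mdist X x z = 3) \<and> \<not> (mdist X x y = 3 \<and> mdist X x z = 3))"
    unfolding class_A3_inf_0_7_8_def mem_Collect_eq
    by (intro conj_cong refl ball_cong imp_cong admissible_triangle_iff) simp_all
  also have "\<dots> \<longleftrightarrow> ?fin \<and> ?dist \<and> ?tri" (is "_ \<and> _ \<and> ?tri' \<longleftrightarrow> _")
  proof -
    have ?tri' if tri: ?tri
    proof (intro ballI impI)
      fix x y z assume "x \<in> mspace X" "y \<in> mspace X" "z \<in> mspace X" "x \<noteq> y \<and> y \<noteq> z \<and> x \<noteq> z"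
      then show "(mdist X x y = 2 \<longleftrightarrow> (mdist X y z = 2 \<longleftrightarrow> mdist X x z = 2)) \<and>
        \<not> (mdist X x y = 3 \<and> mdist X y z = 3) \<and>
        \<not> (mdist X y z = 3 \<and> mdist X x z = 3) \<and> \<not> (mdist X x y = 3 \<and> mdist X x z = 3)"
        \<comment> \<open>Each pair of sides meets in one vertex; the three instances put
          \<open>y\<close>, \<open>z\<close> and \<open>x\<close> in the middle.\<close>
        using tri[rule_format, of x y z] tri[rule_format, of y z x] tri[rule_format, of y x z]
          mdist_commute[of X z x] mdist_commute[of X y x] by metis
    qed
    moreover have ?tri if ?tri'
      using that by blast
    ultimately show ?thesis by blast
  qed
  finally show ?thesis .
qed

text \<open>Carries membership from the models, whose points are natural numbers, to their copies
  over another type.\<close>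

lemma class_A3_inf_0_7_8_isometric:
  assumes "isometric_spaces X Y" "X \<in> class_A3_inf_0_7_8"
  shows "Y \<in> class_A3_inf_0_7_8"
proof -
  obtain f where f: "bij_betw f (mspace X) (mspace Y)"
    and d: "\<And>x y. x \<in> mspace X \<Longrightarrow> y \<in> mspace X \<Longrightarrow> mdist Y (f x) (f y) = mdist X x y"
    using assms(1) unfolding isometric_spaces_def by blast
  have Y: "mspace Y = f ` mspace X"
    using f by (simp add: bij_betw_def)
  have inj: "f x = f y \<longleftrightarrow> x = y" if "x \<in> mspace X" "y \<in> mspace X" for x y
    using bij_betw_imp_inj_on[OF f] that by (auto dest: inj_onD)
  have "Y \<in> class_A3_inf_0_7_8 \<longleftrightarrow> X \<in> class_A3_inf_0_7_8"
    unfolding class_A3_inf_0_7_8_iff Y ball_simps(9)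
    by (intro conj_cong ball_cong refl) (simp_all add: d inj flip: Y bij_betw_finite[OF f])
  with assms(2) show ?thesis by blast
qed

lemma isometric_spaces_card:
  "isometric_spaces X Y \<Longrightarrow> card (mspace X) = card (mspace Y)"
  unfolding isometric_spaces_def using bij_betw_same_card by blast

section \<open>Model spaces and their invariants\<close>

text \<open>Indices below \<open>k\<close> form one part and the others the second; the shift by
  \<open>k\<close> pairs the first \<open>m\<close> indices with their partners at distance
  3.\<close>

definition model_dist :: "nat \<Rightarrow> nat \<Rightarrow> nat \<Rightarrow> nat \<Rightarrow> real" where
  "model_dist k m i j =
     (if i = j then 0 else if i < k \<longleftrightarrow> j < k then 2
      else if (i < m \<and> j = i + k) \<or> (j < m \<and> i = j + k) then 3 else 1)"

definition model_space :: "nat \<Rightarrow> nat \<Rightarrow> nat \<Rightarrow> nat metric" where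
  "model_space n k m = metric ({..<n}, model_dist k m)"

text \<open>The triangle inequality could fail only as 3 > 1 + 1. Points at distance 3 lie in
  different parts, so a third point shares a part with one of them and has distance 2 to it.\<close>

lemma Metric_space_model_dist:
  assumes "m \<le> k"
  shows "Metric_space M (model_dist k m)"
  by unfold_locales (use assms in \<open>auto simp: model_dist_def\<close>)

lemma
  assumes "m \<le> k"
  shows mspace_model_space: "mspace (model_space n k m) = {..<n}"
    and mdist_model_space: "mdist (model_space n k m) = model_dist k m"
  using Metric_space_model_dist[OF assms]
  by (simp_all add: model_space_def Metric_space.mspace_metric Metric_space.mdist_metric)

lemma model_space_in_class:
  assumes "m \<le> k"
  shows "model_space n k m \<in> class_A3_inf_0_7_8"
  using assms
  by (auto simp: class_A3_inf_0_7_8_iff mspace_model_space mdist_model_space model_dist_def)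

text \<open>Two isometry invariants recover the parameters: the size of the part containing a point
  gives \<open>k\<close>, and the number of points having some point at distance 3 gives
  \<open>m\<close>.\<close>

lemma isometric_model_space_unique:
  assumes iso: "isometric_spaces (model_space n k m) (model_space n k' m')"
    and "n > 0" "m \<le> k" "2 * k \<le> n" "m' \<le> k'" "2 * k' \<le> n"
  shows "k = k' \<and> m = m'"
proof -
  obtain f where f: "bij_betw f {..<n} {..<n}"
    and d: "\<And>i j. i < n \<Longrightarrow> j < n \<Longrightarrow> model_dist k' m' (f i) (f j) = model_dist k m i j"
    using iso assms unfolding isometric_spaces_def
    by (auto simp: mspace_model_space mdist_model_space)
  have img: "f ` {..<n} = {..<n}"
    using f by (simp add: bij_betw_def)
  have inj: "inj_on f {..<n}"
    using f by (simp add: bij_betw_def)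
  \<comment> \<open>Distance 0 is included so that the point itself is counted in its part.\<close>
  have part: "card {j. j < n \<and> model_dist k m i j \<in> {0, 2}} = (if i < k then k else n - k)"
    if "i < n" "2 * k \<le> n" for i k m
  proof -
    have "{j. j < n \<and> model_dist k m i j \<in> {0, 2}} = (if i < k then {..<k} else {k..<n})"
      using that by (cases "i < k") (auto simp: model_dist_def)
    then show ?thesis by simp
  qed
  have matched: "card {i. i < n \<and> (\<exists>j<n. model_dist k m i j = 3)} = 2 * m"
    if "m \<le> k" "2 * k \<le> n" for k m
  proof -
    have "{i. i < n \<and> (\<exists>j<n. model_dist k m i j = 3)} = {..<m} \<union> {k..<k + m}"
    proof (intro equalityI subsetI)
      fix i assume "i \<in> {i. i < n \<and> (\<exists>j<n. model_dist k m i j = 3)}"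
      then show "i \<in> {..<m} \<union> {k..<k + m}"
        by (auto simp: model_dist_def split: if_splits)
    next
      fix i assume i: "i \<in> {..<m} \<union> {k..<k + m}"
      define j where "j = (if i < m then i + k else i - k)"
      have "i < n" "j < n" "model_dist k m i j = 3"
        using i that by (auto simp: j_def model_dist_def)
      then show "i \<in> {i. i < n \<and> (\<exists>j<n. model_dist k m i j = 3)}"
        by blast
    qed
    moreover have "{..<m} \<inter> {k..<k + m} = {}"
      using that by auto
    ultimately show ?thesis
      by (simp add: card_Un_disjoint)
  qed
  have "{j. j < n \<and> model_dist k' m' (f 0) j \<in> {0, 2}} =
      f ` {j. j < n \<and> model_dist k m 0 j \<in> {0, 2}}" (is "?L = f ` ?R")
  proof (intro equalityI subsetI)
    fix y assume "y \<in> ?L"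
    moreover from this obtain j where "y = f j" "j < n"
      using img by (auto simp: image_iff)
    ultimately show "y \<in> f ` ?R"
      using d[of 0 j] \<open>n > 0\<close> by auto
  next
    fix y assume "y \<in> f ` ?R"
    then show "y \<in> ?L"
      using img d[of 0] \<open>n > 0\<close> by auto
  qed
  moreover have "inj_on f ?R"
    by (rule inj_on_subset[OF inj]) auto
  ultimately have "card ?L = card ?R"
    by (simp add: card_image)
  moreover have "f 0 < n"
    using img \<open>n > 0\<close> by auto
  \<comment> \<open>\<open>f\<close> may send 0 into either part, so the sizes may compare as
    \<open>k = n - k'\<close>; as neither \<open>k\<close> nor \<open>k'\<close> exceeds half of
    \<open>n\<close>, both then equal that half.\<close>
  ultimately have "k = k'"
    using part[of "f 0" k' m'] part[of 0 k m] assms by (auto split: if_splits)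
  have "{i. i < n \<and> (\<exists>j<n. model_dist k' m' i j = 3)} =
      f ` {i. i < n \<and> (\<exists>j<n. model_dist k m i j = 3)}" (is "?L = f ` ?R")
  proof (intro equalityI subsetI)
    fix y assume "y \<in> ?L"
    then obtain z where "y \<in> f ` {..<n}" "z \<in> f ` {..<n}" "model_dist k' m' y z = 3"
      using img by auto
    then obtain i j where "i < n" "j < n" "y = f i" "model_dist k m i j = 3"
      using d by auto
    then show "y \<in> f ` ?R"
      by blast
  next
    fix y assume "y \<in> f ` ?R"
    then obtain i j where "y = f i" "i < n" "j < n" "model_dist k m i j = 3"
      by auto
    moreover from this have "f i < n" "f j < n"
      using img by auto
    ultimately show "y \<in> ?L"
      using d[of i j] by auto
  qed
  moreover have "inj_on f ?R"
    by (rule inj_on_subset[OF inj]) auto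
  ultimately have "card ?L = card ?R"
    by (simp add: card_image)
  then show ?thesis
    using matched[of m k] matched[of m' k'] assms \<open>k = k'\<close> by simp
qed

section \<open>Every space in the class is isometric to a model\<close>

text \<open>List the matched points of \<open>A\<close>, the rest of \<open>A\<close>, the partners
  in the same order as the matched points, then the rest of \<open>B\<close>. This enumeration is an
  isometry from the model.\<close>

lemma two_part_isometric_model_space:
  assumes fin: "finite A" "finite B"
    and AB: "mspace X = A \<union> B" "A \<inter> B = {}" "card A \<le> card B"
    and dA: "\<And>x y. x \<in> A \<Longrightarrow> y \<in> A \<Longrightarrow> x \<noteq> y \<Longrightarrow> mdist X x y = 2"
    and dB: "\<And>x y. x \<in> B \<Longrightarrow> y \<in> B \<Longrightarrow> x \<noteq> y \<Longrightarrow> mdist X x y = 2"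
    and cross: "\<And>x y. x \<in> A \<Longrightarrow> y \<in> B \<Longrightarrow> mdist X x y = 1 \<or> mdist X x y = 3"
    and matching: "\<And>x y z. x \<in> mspace X \<Longrightarrow> y \<in> mspace X \<Longrightarrow> z \<in> mspace X \<Longrightarrow>
      mdist X x y = 3 \<Longrightarrow> mdist X x z = 3 \<Longrightarrow> y = z"
  shows "\<exists>m \<le> card A. isometric_spaces (model_space (card A + card B) (card A) m) X"
proof -
  define M where "M = {a\<in>A. \<exists>b\<in>B. mdist X a b = 3}"
  define k n m where "k = card A" and "n = card A + card B" and "m = card M"
  have "M \<subseteq> A" and finM: "finite M"
    using fin by (auto simp: M_def)
  then have "m \<le> k"
    using fin by (simp add: m_def k_def card_mono)
  have "2 * k \<le> n"
    using AB by (simp add: k_def n_def)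
  have "\<forall>a\<in>M. \<exists>b. b \<in> B \<and> mdist X a b = 3"
    unfolding M_def by blast
  then obtain p where p: "\<And>a. a \<in> M \<Longrightarrow> p a \<in> B \<and> mdist X a (p a) = 3"
    using bchoice by metis
  \<comment> \<open>Two points with a common partner would both be at distance 3 from it.\<close>
  have "inj_on p M"
  proof (rule inj_onI)
    fix x y assume "x \<in> M" "y \<in> M" "p x = p y"
    then show "x = y"
      using p[of x] p[of y] \<open>M \<subseteq> A\<close> AB matching[of "p x" x y] by (auto simp: mdist_commute)
  qed
  then have pM: "bij_betw p M (p ` M)" and cpM: "card (p ` M) = m"
    by (simp_all add: bij_betw_def m_def card_image)
  have pMB: "p ` M \<subseteq> B"
    using p by blast
  obtain e1 where e1: "bij_betw e1 {..<m} M"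
    using finite_same_card_bij[of "{..<m}" M] finM by (auto simp: m_def)
  obtain e2 where e2: "bij_betw e2 {m..<k} (A - M)"
    using finite_same_card_bij[of "{m..<k}" "A - M"] fin finM \<open>M \<subseteq> A\<close>
    by (auto simp: card_Diff_subset m_def k_def)
  obtain e3 where e3: "bij_betw e3 {k + m..<n} (B - p ` M)"
    using finite_same_card_bij[of "{k + m..<n}" "B - p ` M"] fin finM pMB cpM
    by (auto simp: card_Diff_subset k_def n_def)
  \<comment> \<open>The third block reuses \<open>e1\<close> shifted by \<open>k\<close>, which puts
    the partner of \<open>g i\<close> at index \<open>i + k\<close>, as \<open>model_dist\<close>
    demands.\<close>
  define g where "g i = (if i < m then e1 i else if i < k then e2 i
    else if i < k + m then p (e1 (i - k)) else e3 i)" for i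
  have g1: "bij_betw g {..<m} M"
    using e1 by (rule bij_betw_cong[THEN iffD1, rotated]) (simp add: g_def)
  have g2: "bij_betw g {m..<k} (A - M)"
    using e2 by (rule bij_betw_cong[THEN iffD1, rotated]) (simp add: g_def)
  have "bij_betw (\<lambda>i. i - k) {k..<k + m} {..<m}"
    by (rule bij_betwI[where g = "\<lambda>i. i + k"]) auto
  then have "bij_betw (p \<circ> (e1 \<circ> (\<lambda>i. i - k))) {k..<k + m} (p ` M)"
    by (intro bij_betw_trans[OF _ pM] bij_betw_trans[OF _ e1])
  then have g3: "bij_betw g {k..<k + m} (p ` M)"
    by (rule bij_betw_cong[THEN iffD1, rotated]) (use \<open>m \<le> k\<close> in \<open>simp add: g_def\<close>)
  have g4: "bij_betw g {k + m..<n} (B - p ` M)"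
    using e3 by (rule bij_betw_cong[THEN iffD1, rotated]) (simp add: g_def)
  have "bij_betw g ({..<m} \<union> {m..<k}) (M \<union> (A - M))"
    by (rule bij_betw_combine[OF g1 g2]) auto
  then have gA: "bij_betw g {..<k} A"
    using \<open>m \<le> k\<close> \<open>M \<subseteq> A\<close> by (simp add: ivl_disj_un Un_absorb1)
  have "bij_betw g ({k..<k + m} \<union> {k + m..<n}) (p ` M \<union> (B - p ` M))"
    by (rule bij_betw_combine[OF g3 g4]) auto
  then have gB: "bij_betw g {k..<n} B"
    using \<open>m \<le> k\<close> \<open>2 * k \<le> n\<close> pMB by (simp add: ivl_disj_un Un_absorb1)
  have "bij_betw g ({..<k} \<union> {k..<n}) (A \<union> B)"
    by (rule bij_betw_combine[OF gA gB AB(2)])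
  then have gX: "bij_betw g {..<n} (mspace X)"
    using \<open>2 * k \<le> n\<close> AB by (simp add: ivl_disj_un)
  have ginj: "g i = g j \<longleftrightarrow> i = j" if "i < n" "j < n" for i j
    using bij_betw_imp_inj_on[OF gX] that by (auto dest: inj_onD)
  have inA: "g i \<in> A" if "i < k" for i
    using bij_betw_apply[OF gA] that by simp
  have inB: "g i \<in> B" if "k \<le> i" "i < n" for i
    using bij_betw_apply[OF gB] that by simp
  have matched: "mdist X (g i) (g (i + k)) = 3" if "i < m" for i
    using p[of "e1 i"] bij_betw_apply[OF e1] that \<open>m \<le> k\<close> by (simp add: g_def)
  have cross_dist: "mdist X (g i) (g j) = model_dist k m i j" if "i < k" "k \<le> j" "j < n" for i j
  proof (cases "i < m \<and> j = i + k")
    case True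
    with that matched show ?thesis
      by (auto simp: model_dist_def)
  next
    case False
    \<comment> \<open>Distance 3 would put \<open>g i\<close> in \<open>M\<close>, hence
      \<open>i < m\<close> because the block from \<open>m\<close> to \<open>k\<close> avoids
      \<open>M\<close>. The partner is unique, so \<open>j = i + k\<close>, the case already
      excluded.\<close>
    have "mdist X (g i) (g j) \<noteq> 3"
    proof
      assume three: "mdist X (g i) (g j) = 3"
      have "g i \<in> M"
        using three inA inB that by (auto simp: M_def)
      have "i < m"
      proof (rule ccontr)
        assume "\<not> i < m"
        then show False
          using bij_betw_apply[OF g2, of i] \<open>g i \<in> M\<close> that by simp
      qed
      then have "g j = g (i + k)"
        using matching[OF _ _ _ three matched[OF \<open>i < m\<close>]] bij_betw_apply[OF gX] that
          \<open>m \<le> k\<close> \<open>2 * k \<le> n\<close> by simp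
      then show False
        using False \<open>i < m\<close> ginj[of j "i + k"] that \<open>2 * k \<le> n\<close> by simp
    qed
    then show ?thesis
      using False that \<open>m \<le> k\<close> cross[OF inA inB, of i j] by (auto simp: model_dist_def)
  qed
  have model_sym: "model_dist k m i j = model_dist k m j i" for i j
    by (auto simp: model_dist_def)
  have "mdist X (g i) (g j) = model_dist k m i j" if "i < n" "j < n" for i j
  proof -
    consider "i = j" | "i \<noteq> j" "i < k" "j < k" | "i \<noteq> j" "k \<le> i" "k \<le> j"
      | "i < k" "k \<le> j" | "j < k" "k \<le> i"
      by linarith
    then show ?thesis
    proof cases
      case 1
      with that show ?thesis
        using bij_betw_apply[OF gX, of i] by (simp add: model_dist_def)
    next
      case 2
      with that show ?thesis
        using dA[OF inA inA, of i j] ginj[of i j] by (simp add: model_dist_def)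
    next
      case 3
      with that show ?thesis
        using dB[OF inB inB, of i j] ginj[of i j] by (simp add: model_dist_def)
    next
      case 4
      with that show ?thesis
        by (simp add: cross_dist)
    next
      case 5
      with that show ?thesis
        using cross_dist[of j i] mdist_commute[of X "g i" "g j"] model_sym[of i j] by simp
    qed
  qed
  then have "isometric_spaces (model_space n k m) X"
    unfolding isometric_spaces_def using gX \<open>m \<le> k\<close>
    by (intro exI[of _ g]) (simp add: mspace_model_space mdist_model_space)
  then show ?thesis
    using \<open>m \<le> k\<close> unfolding k_def n_def by blast
qed

text \<open>By parity, being equal or at distance 2 is an equivalence relation with at most two
  classes; these are the parts, and the smaller one supplies \<open>k\<close>.\<close>

lemma class_isometric_model_space:
  assumes X: "X \<in> class_A3_inf_0_7_8" and n: "card (mspace X) = n" "n > 0"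
  shows "\<exists>k m. m \<le> k \<and> 2 * k \<le> n \<and> isometric_spaces (model_space n k m) X"
proof -
  have fin: "finite (mspace X)"
    and dist: "\<And>x y. x \<in> mspace X \<Longrightarrow> y \<in> mspace X \<Longrightarrow> x \<noteq> y \<Longrightarrow> mdist X x y \<in> {1, 2, 3}"
    and parity: "\<And>x y z. x \<in> mspace X \<Longrightarrow> y \<in> mspace X \<Longrightarrow> z \<in> mspace X \<Longrightarrow>
      x \<noteq> y \<Longrightarrow> y \<noteq> z \<Longrightarrow> x \<noteq> z \<Longrightarrow>
      mdist X x y = 2 \<longleftrightarrow> (mdist X y z = 2 \<longleftrightarrow> mdist X x z = 2)"
    and no33: "\<And>x y z. x \<in> mspace X \<Longrightarrow> y \<in> mspace X \<Longrightarrow> z \<in> mspace X \<Longrightarrow>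
      x \<noteq> y \<Longrightarrow> y \<noteq> z \<Longrightarrow> x \<noteq> z \<Longrightarrow> \<not> (mdist X x y = 3 \<and> mdist X y z = 3)"
    using X unfolding class_A3_inf_0_7_8_iff by blast+
  have matching: "y = z" if "x \<in> mspace X" "y \<in> mspace X" "z \<in> mspace X"
    "mdist X x y = 3" "mdist X x z = 3" for x y z
    \<comment> \<open>The two sides of length 3 meet at \<open>x\<close>, so \<open>x\<close> is the
      middle vertex.\<close>
    using no33[of y x z] that by (metis mdist_commute mdist_zero zero_neq_numeral)
  obtain u where u: "u \<in> mspace X"
    using n by (metis all_not_in_conv card.empty less_numeral_extra(3))
  \<comment> \<open>The class of a base point \<open>u\<close>; every distance within or between the
    parts is then read off from the triangle with third vertex \<open>u\<close>.\<close>
  define A where "A = {x \<in> mspace X. x = u \<or> mdist X u x = 2}"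
  define B where "B = mspace X - A"
  have AB: "mspace X = A \<union> B" "A \<inter> B = {}" "finite A" "finite B"
    using fin by (auto simp: A_def B_def)
  have dA: "mdist X x y = 2" if "x \<in> A" "y \<in> A" "x \<noteq> y" for x y
    using that parity[of u x y] u by (cases "x = u"; cases "y = u") (auto simp: A_def mdist_commute)
  have dB: "mdist X x y = 2" if "x \<in> B" "y \<in> B" "x \<noteq> y" for x y
    \<comment> \<open>Neither side at \<open>u\<close> is 2, and the number of sides equal to 2 is
      odd, so the third side is 2.\<close>
    using that parity[of u x y] u by (auto simp: A_def B_def)
  have cross: "mdist X x y = 1 \<or> mdist X x y = 3" if "x \<in> A" "y \<in> B" for x y
  proof -
    have "mdist X x y \<noteq> 2" "x \<noteq> y"
      using that parity[of u x y] u by (auto simp: A_def B_def)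
    moreover have "x \<in> mspace X" "y \<in> mspace X"
      using that by (simp_all add: A_def B_def)
    ultimately show ?thesis
      using dist by blast
  qed
  have card_n: "card A + card B = n"
    using n AB(1) card_Un_disjoint[OF AB(3,4,2)] by simp
  show ?thesis
  proof (cases "card A \<le> card B")
    case True
    have "\<exists>m \<le> card A. isometric_spaces (model_space (card A + card B) (card A) m) X"
      by (rule two_part_isometric_model_space) (fact AB True dA dB cross matching)+
    then obtain m where "m \<le> card A" "isometric_spaces (model_space n (card A) m) X"
      using card_n by auto
    then show ?thesis
      using True card_n by (intro exI[of _ "card A"] exI[of _ m]) simp
  next
    case False
    \<comment> \<open>The smaller part must come first in the model, so \<open>A\<close> and
      \<open>B\<close> exchange roles.\<close>
    have "\<exists>m \<le> card B. isometric_spaces (model_space (card B + card A) (card B) m) X"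
    proof (rule two_part_isometric_model_space)
      show "mdist X x y = 1 \<or> mdist X x y = 3" if "x \<in> B" "y \<in> A" for x y
        using cross[OF that(2,1)] by (simp add: mdist_commute)
      show "mspace X = B \<union> A" "B \<inter> A = {}" "card B \<le> card A"
        using AB False by auto
    qed (fact AB dA dB matching)+
    then obtain m where "m \<le> card B" "isometric_spaces (model_space n (card B) m) X"
      using card_n by (auto simp: add.commute)
    then show ?thesis
      using False card_n by (intro exI[of _ "card B"] exI[of _ m]) simp
  qed
qed

section \<open>Counting the isometry classes\<close>

text \<open>The pairs \<open>(k, m)\<close> with \<open>m \<le> k\<close> and
  \<open>2 * k \<le> n\<close> index the classes: every space has a model, and different models are
  not isometric.\<close>

lemma card_isometry_classes:
  assumes "infinite (UNIV :: 'a set)" and "n > 0"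
  shows "card (isometry_classes {X \<in> (class_A3_inf_0_7_8 :: 'a metric set). card (mspace X) = n})
    = card (SIGMA k:{..n div 2}. {..k})"
proof -
  define S where "S = {X \<in> (class_A3_inf_0_7_8 :: 'a metric set). card (mspace X) = n}"
  define R where "R = {(X, Y). X \<in> S \<and> Y \<in> S \<and> isometric_spaces X Y}"
  define K where "K = (SIGMA k:{..n div 2}. {..k})"
  \<comment> \<open>The model itself need not lie over \<open>'a\<close>, so its class is described
    as all spaces of \<open>S\<close> isometric to it.\<close>
  define c where "c = (\<lambda>(k, m). {X \<in> S. isometric_spaces (model_space n k m) X})"
  have class_eq: "R `` {X} = c (k, m)" if "X \<in> S" "isometric_spaces (model_space n k m) X" for X k m
  proof -
    have "isometric_spaces X Y \<longleftrightarrow> isometric_spaces (model_space n k m) Y" for Y :: "'a metric"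
      using isometric_spaces_trans[OF that(2)] isometric_spaces_trans[OF isometric_spaces_sym[OF that(2)]]
      by blast
    then show ?thesis
      using that(1) by (auto simp: R_def c_def)
  qed
  have in_K: "(k, m) \<in> K \<longleftrightarrow> m \<le> k \<and> 2 * k \<le> n" for k m
    by (auto simp: K_def)
  \<comment> \<open>An infinite type has room for a copy of each model, so no
    \<open>c (k, m)\<close> is empty. Injectivity of \<open>c\<close> rests on this: a common member
    of two classes makes their models isometric.\<close>
  have realised: "\<exists>X \<in> S. isometric_spaces (model_space n k m) X" if "(k, m) \<in> K" for k m
  proof -
    have "m \<le> k"
      using that in_K by simp
    then obtain X :: "'a metric" where X: "isometric_spaces (model_space n k m) X"
      using isometric_copy_exists[OF _ assms(1), of "model_space n k m"]
      by (auto simp: mspace_model_space)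
    then have "X \<in> S"
      using class_A3_inf_0_7_8_isometric[OF X model_space_in_class[OF \<open>m \<le> k\<close>]]
        isometric_spaces_card[OF X] \<open>m \<le> k\<close> by (simp add: S_def mspace_model_space)
    with X show ?thesis by blast
  qed
  have "bij_betw c K (S // R)"
  proof (rule bij_betw_imageI)
    show "inj_on c K"
    proof (rule inj_onI, clarify)
      fix k m k' m'
      assume km: "(k, m) \<in> K" "(k', m') \<in> K" and eq: "c (k, m) = c (k', m')"
      obtain X where X: "X \<in> S" "isometric_spaces (model_space n k m) X"
        using realised[OF km(1)] by blast
      then have "isometric_spaces (model_space n k' m') X"
        using eq by (auto simp: c_def)
      with X have "isometric_spaces (model_space n k m) (model_space n k' m')"
        using isometric_spaces_trans[OF X(2)] isometric_spaces_sym by blast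
      then show "k = k' \<and> m = m'"
        using isometric_model_space_unique km \<open>n > 0\<close> by (simp add: in_K)
    qed
    show "c ` K = S // R"
    proof (intro equalityI subsetI)
      fix C assume "C \<in> c ` K"
      then obtain k m where km: "(k, m) \<in> K" "C = c (k, m)"
        by auto
      then obtain X where "X \<in> S" "isometric_spaces (model_space n k m) X"
        using realised by blast
      then show "C \<in> S // R"
        using class_eq km by (metis quotientI)
    next
      fix C assume "C \<in> S // R"
      then obtain X where X: "X \<in> S" "C = R `` {X}"
        by (auto elim: quotientE)
      then obtain k m where "m \<le> k" "2 * k \<le> n" "isometric_spaces (model_space n k m) X"
        using class_isometric_model_space[of X n] \<open>n > 0\<close> by (auto simp: S_def)
      then show "C \<in> c ` K"
        using X class_eq in_K by (metis image_eqI)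
    qed
  qed
  then have "card K = card (S // R)"
    by (rule bij_betw_same_card)
  then show ?thesis
    by (simp add: isometry_classes_def S_def R_def K_def)
qed

theorem theorem2p9:
  fixes n :: nat
  assumes "infinite (UNIV :: 'a set)" and "n > 0"
  shows "real (card (isometry_classes
                 {X \<in> (class_A3_inf_0_7_8 :: 'a metric set). card (mspace X) = n}))
         = (real_of_int \<lfloor>real n / 2\<rfloor>)\<^sup>2 / 2 + 3 * real_of_int \<lfloor>real n / 2\<rfloor> / 2 + 1"
proof -
  have "\<lfloor>real n / 2\<rfloor> = int (n div 2)"
    using floor_divide_of_nat_eq[of n 2] by simp
  \<comment> \<open>Each \<open>k\<close> admits the \<open>k + 1\<close> values 0 to
    \<open>k\<close> of \<open>m\<close>; the total \<open>(h + 1) * (h + 2) / 2\<close> is the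
    stated formula with \<open>h = n div 2\<close>.\<close>
  moreover have "real (\<Sum>k\<le>h. Suc k) = (real h)\<^sup>2 / 2 + 3 * real h / 2 + 1" for h
    by (induction h) (simp_all add: power2_eq_square field_simps)
  ultimately show ?thesis
    using card_isometry_classes[OF assms] by simp
qed

end
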